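(* Let $s\ge m$ be two positive integers. Suppose that $S$ and $X$ are independent random variables, assuming values in the set of non-negative integers, such that $S$ is right-skewed with mode $s$, and $X$ is left-loaded with mean $m$. Then $$\mathbb{P}(S \ge s) \ \ge\ \mathbb{P}(S+X \ge s+m).$$
   Context: For a positive integer $m$, write $[m]=\{1,\ldots,m\}$. Right-skewness: Let $S$ be a random variable taking values in the set of non-negative integers, and assume that $S$ is unimodal with mode $s$ (that is, $j\mapsto \mathbb{P}(S=j)$ is non-decreasing for $0\le j\le s$ and non-increasing for $j\ge s$). Then $S$ is called right-skewed (with mode $s$) if $\mathbb{P}(S=s-i)\le \mathbb{P}(S=s+i-1)$ for all $i\in[s]$. Left-loadedness: Let $X$ be a random variable taking values in the set of non-negative integers whose mean $m:=\mathbb{E}(X)$ is an integer. For $i\in[m]$ set $\alpha_i:=\mathbb{P}(X\le m-i)-\mathbb{P}(X\ge m+i)$. Then $X$ is said to be left-loaded if at least one of the following two conditions holds: (1) there exists $\ell\in[m]$ such that $\alpha_i\ge 0$ for all $i\in[m]$ with $i\le \ell$, and $\alpha_i\le 0$ for all $i\in[m]$ with $i>\ell$; (2) $\sum_{i=1}^{k}\alpha_i\ge 0$ for all $k\in[m]$. *)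

theory Defs
  imports "HOL-Probability.Probability"
begin

definition unimodal_rv :: "'w measure \<Rightarrow> ('w \<Rightarrow> nat) \<Rightarrow> nat \<Rightarrow> bool" where
  "unimodal_rv M S s \<longleftrightarrow>
     (\<forall>i j. i \<le> j \<longrightarrow> j \<le> s \<longrightarrow> \<P>(\<omega> in M. S \<omega> = i) \<le> \<P>(\<omega> in M. S \<omega> = j)) \<and>
     (\<forall>i j. s \<le> i \<longrightarrow> i \<le> j \<longrightarrow> \<P>(\<omega> in M. S \<omega> = j) \<le> \<P>(\<omega> in M. S \<omega> = i))"

definition right_skewed :: "'w measure \<Rightarrow> ('w \<Rightarrow> nat) \<Rightarrow> nat \<Rightarrow> bool" where
  "right_skewed M S s \<longleftrightarrow>
     unimodal_rv M S s \<and>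
     (\<forall>i\<in>{1..s}. \<P>(\<omega> in M. S \<omega> = s - i) \<le> \<P>(\<omega> in M. S \<omega> = s + i - 1))"

definition tail_diff :: "'w measure \<Rightarrow> ('w \<Rightarrow> nat) \<Rightarrow> nat \<Rightarrow> nat \<Rightarrow> real" where
  "tail_diff M X m i = \<P>(\<omega> in M. X \<omega> \<le> m - i) - \<P>(\<omega> in M. X \<omega> \<ge> m + i)"

(* Integrability is required separately because the Bochner integral of a
   non-integrable function is 0 by convention. *)
definition has_mean :: "'w measure \<Rightarrow> ('w \<Rightarrow> nat) \<Rightarrow> nat \<Rightarrow> bool" where
  "has_mean M X m \<longleftrightarrow>
     integrable M (\<lambda>\<omega>. real (X \<omega>)) \<and> (\<integral>\<omega>. real (X \<omega>) \<partial>M) = real m"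

definition left_loaded :: "'w measure \<Rightarrow> ('w \<Rightarrow> nat) \<Rightarrow> nat \<Rightarrow> bool" where
  "left_loaded M X m \<longleftrightarrow>
     has_mean M X m \<and>
     ((\<exists>l\<in>{1..m}. (\<forall>i\<in>{1..m}. i \<le> l \<longrightarrow> tail_diff M X m i \<ge> 0) \<and>
                   (\<forall>i\<in>{1..m}. i > l \<longrightarrow> tail_diff M X m i \<le> 0)) \<or>
      (\<forall>k\<in>{1..m}. (\<Sum>i=1..k. tail_diff M X m i) \<ge> 0))"

end

theory Submission
  imports Defs
begin

text \<open>
  Write \<open>p j = P(S = j)\<close> and \<open>\<alpha> i = P(X \<le> m - i) - P(X \<ge> m + i)\<close>. Passing from \<open>S \<ge> s\<close> to
  \<open>S + X \<ge> s + m\<close> loses the outcomes \<open>S = s + i - 1, X \<le> m - i\<close> with \<open>1 \<le> i \<le> m\<close> and gains the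
  outcomes \<open>S = s - i, X \<ge> m + i\<close> with \<open>1 \<le> i \<le> s\<close>. By independence, the loss is
  \<open>(\<Sum>i=1..m. p (s+i-1) * P(X \<le> m-i))\<close> and the gain is \<open>(\<Sum>i=1..s. p (s-i) * P(X \<ge> m+i))\<close>, and
  the gain has to be bounded by the loss.

  Right-skewness allows \<open>p (s-i)\<close> to be replaced by \<open>p (s+i-1)\<close> for \<open>i \<le> m\<close>, and unimodality gives
  \<open>p (s-i) \<le> p (s-m) \<le> p (s+m-1)\<close> for \<open>i > m\<close>. It therefore suffices that
  \<open>(\<Sum>i=1..m. p (s+i-1) * \<alpha> i) \<ge> p (s+m-1) * (\<Sum>i=m+1..s. P(X \<ge> m+i))\<close>. Two facts about \<open>X\<close>
  give this. Since \<open>X\<close> has mean \<open>m\<close>, its deviations below and above \<open>m\<close> balance, so the \<open>\<alpha> i\<close>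
  with \<open>i \<le> m\<close> sum to at least \<open>(\<Sum>i=m+1..s. P(X \<ge> m+i))\<close> (lemma \<open>sum_tail_diff_ge\<close>). Left-loadedness,
  in either form, makes all partial sums of \<open>\<alpha>\<close> nonnegative (lemma \<open>left_loaded_partial_sums\<close>), so
  that summation by parts against the nonincreasing weights \<open>p (s+i-1)\<close> bounds the weighted sum from
  below by the last weight times the total (lemma \<open>weighted_sum_ge_last_weight\<close>).
\<close>

lemma sum_split_at:
  fixes f :: "nat \<Rightarrow> real"
  assumes "k \<le> n"
  shows "(\<Sum>i=1..n. f i) = (\<Sum>i=1..k. f i) + (\<Sum>i=k+1..n. f i)"
  using sum.ub_add_nat[of 1 k f "n - k"] assms by simp

text \<open>
  Abel summation: lowering the weight of every earlier term to the current one removes a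
  nonnegative multiple of a partial sum.
\<close>

lemma weighted_sum_ge_last_weight:
  fixes w a :: "nat \<Rightarrow> real"
  assumes "\<And>i. 1 \<le> i \<Longrightarrow> i < n \<Longrightarrow> w (Suc i) \<le> w i"
    and "\<And>k. k < n \<Longrightarrow> 0 \<le> (\<Sum>i=1..k. a i)"
  shows "w n * (\<Sum>i=1..n. a i) \<le> (\<Sum>i=1..n. w i * a i)"
  using assms
proof (induction n)
  case 0
  then show ?case by simp
next
  case (Suc n)
  have "w (Suc n) * (\<Sum>i=1..n. a i) \<le> w n * (\<Sum>i=1..n. a i)"
  proof (cases "n = 0")
    case False
    then show ?thesis
      using Suc.prems by (intro mult_right_mono) auto
  qed simp
  also have "\<dots> \<le> (\<Sum>i=1..n. w i * a i)"
    using Suc by auto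
  finally show ?case
    by (simp add: distrib_left)
qed

context prob_space
begin

text \<open>
  Since \<open>(\<Sum>i=1..m. P(X \<le> m - i)) = E (m - X)\<^sup>+\<close> and \<open>(\<Sum>i=1..n. P(X \<ge> m + i)) \<le> E (X - m)\<^sup>+\<close>, the
  inequality follows from \<open>E (X - m) = 0\<close>. Cutting the upper tail off at a finite \<open>n\<close> avoids
  infinite series.
\<close>

lemma sum_upper_tails_le_sum_lower_tails:
  assumes X: "X \<in> measurable M (count_space UNIV)" and "has_mean M X m"
  shows "(\<Sum>i=1..n. \<P>(\<omega> in M. X \<omega> \<ge> m + i)) \<le> (\<Sum>i=1..m. \<P>(\<omega> in M. X \<omega> \<le> m - i))"
proof -
  note [measurable] = X
  have int: "integrable M (\<lambda>\<omega>. real (X \<omega>))" and mean: "expectation (\<lambda>\<omega>. real (X \<omega>)) = real m"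
    using assms by (auto simp: has_mean_def)
  let ?U = "\<lambda>i. {\<omega> \<in> space M. X \<omega> \<ge> m + i}" and ?L = "\<lambda>i. {\<omega> \<in> space M. X \<omega> \<le> m - i}"
  have intU: "integrable M (indicat_real (?U i))" and intL: "integrable M (indicat_real (?L i))" for i
    by (auto intro!: integrable_real_indicator simp: emeasure_eq_measure)
  have pointwise: "(\<Sum>i=1..n. indicat_real (?U i) \<omega>)
      \<le> (\<Sum>i=1..m. indicat_real (?L i) \<omega>) + (real (X \<omega>) - real m)" if "\<omega> \<in> space M" for \<omega>
  proof -
    have "(\<Sum>i=1..n. indicat_real (?U i) \<omega>) = real (card {i \<in> {1..n}. X \<omega> \<ge> m + i})"
      using that by (simp add: indicator_def sum.If_cases Int_def)
    moreover have "card {i \<in> {1..n}. X \<omega> \<ge> m + i} \<le> card {1..X \<omega> - m}"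
      by (intro card_mono) auto
    moreover have "(\<Sum>i=1..m. indicat_real (?L i) \<omega>) = real (card {i \<in> {1..m}. X \<omega> \<le> m - i})"
      using that by (simp add: indicator_def sum.If_cases Int_def)
    moreover have "{i \<in> {1..m}. X \<omega> \<le> m - i} = {1..m - X \<omega>}"
      by auto
    ultimately show ?thesis
      by (simp add: of_nat_diff)
  qed
  have "(\<Sum>i=1..n. prob (?U i)) = expectation (\<lambda>\<omega>. \<Sum>i=1..n. indicat_real (?U i) \<omega>)"
    using intU by (subst Bochner_Integration.integral_sum) (auto intro!: sum.cong)
  also have "\<dots> \<le> expectation (\<lambda>\<omega>. (\<Sum>i=1..m. indicat_real (?L i) \<omega>) + (real (X \<omega>) - real m))"
    using pointwise intU intL int
    by (intro integral_mono) auto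
  also have "\<dots> = expectation (\<lambda>\<omega>. \<Sum>i=1..m. indicat_real (?L i) \<omega>)"
    using intL int mean by (subst Bochner_Integration.integral_add) (auto simp: prob_space)
  also have "\<dots> = (\<Sum>i=1..m. prob (?L i))"
    using intL by (subst Bochner_Integration.integral_sum) (auto intro!: sum.cong)
  finally show ?thesis .
qed

lemma sum_tail_diff_ge:
  assumes "X \<in> measurable M (count_space UNIV)" and "has_mean M X m" and "m \<le> n"
  shows "(\<Sum>i=m+1..n. \<P>(\<omega> in M. X \<omega> \<ge> m + i)) \<le> (\<Sum>i=1..m. tail_diff M X m i)"
proof -
  have "(\<Sum>i=1..n. \<P>(\<omega> in M. X \<omega> \<ge> m + i)) =
      (\<Sum>i=1..m. \<P>(\<omega> in M. X \<omega> \<ge> m + i)) + (\<Sum>i=m+1..n. \<P>(\<omega> in M. X \<omega> \<ge> m + i))"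
    using \<open>m \<le> n\<close> by (rule sum_split_at)
  then show ?thesis
    using sum_upper_tails_le_sum_lower_tails[OF assms(1,2), of n]
    by (simp add: tail_diff_def sum_subtractf)
qed

text \<open>
  In the single-sign-change case the partial sums first increase from \<open>0\<close> and then decrease to
  the total, which is nonnegative by the mean condition. So the first form of left-loadedness
  implies the second.
\<close>

lemma left_loaded_partial_sums:
  assumes X: "X \<in> measurable M (count_space UNIV)" and "left_loaded M X m" and "k \<le> m"
  shows "0 \<le> (\<Sum>i=1..k. tail_diff M X m i)"
proof (cases "\<forall>k\<in>{1..m}. 0 \<le> (\<Sum>i=1..k. tail_diff M X m i)")
  case True
  then show ?thesis
    using \<open>k \<le> m\<close> by (cases "k = 0") auto
next
  case False
  then obtain l where pos: "\<And>i. i \<in> {1..m} \<Longrightarrow> i \<le> l \<Longrightarrow> 0 \<le> tail_diff M X m i"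
    and neg: "\<And>i. i \<in> {1..m} \<Longrightarrow> l < i \<Longrightarrow> tail_diff M X m i \<le> 0"
    and mean: "has_mean M X m"
    using assms(2) unfolding left_loaded_def by blast
  show ?thesis
  proof (cases "k \<le> l")
    case True
    then show ?thesis
      using pos \<open>k \<le> m\<close> by (intro sum_nonneg) auto
  next
    case False
    have "0 \<le> (\<Sum>i=1..m. tail_diff M X m i)"
      using sum_tail_diff_ge[OF X mean order_refl] by simp
    also have "\<dots> = (\<Sum>i=1..k. tail_diff M X m i) + (\<Sum>i=k+1..m. tail_diff M X m i)"
      using \<open>k \<le> m\<close> by (rule sum_split_at)
    also have "(\<Sum>i=k+1..m. tail_diff M X m i) \<le> 0"
      using False neg by (intro sum_nonpos) auto
    finally show ?thesis by simp
  qed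
qed

text \<open>
  The outcomes in \<open>S \<ge> s\<close> but not in \<open>S + X \<ge> s + m\<close> are split according to the excess
  \<open>i = S + 1 - s\<close>, which lies in \<open>{1..m}\<close> because \<open>X \<ge> 0\<close>; those in the second event only are split
  according to the deficit \<open>i = s - S\<close>. Independence factors each piece.
\<close>

lemma prob_shift_decomposition:
  fixes S X :: "'a \<Rightarrow> nat"
  assumes indep: "indep_var (count_space UNIV) S (count_space UNIV) X"
  shows "\<P>(\<omega> in M. S \<omega> \<ge> s) - \<P>(\<omega> in M. S \<omega> + X \<omega> \<ge> s + m) =
    (\<Sum>i=1..m. \<P>(\<omega> in M. S \<omega> = s + i - 1) * \<P>(\<omega> in M. X \<omega> \<le> m - i)) -
    (\<Sum>i=1..s. \<P>(\<omega> in M. S \<omega> = s - i) * \<P>(\<omega> in M. X \<omega> \<ge> m + i))"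
proof -
  have rv [measurable]:
      "S \<in> measurable M (count_space UNIV)" "X \<in> measurable M (count_space UNIV)"
    using indep_var_rv1[OF indep] indep_var_rv2[OF indep] by auto
  \<comment> \<open>Borel measurability is what the measurability rules need for the sum \<open>S + X\<close>.\<close>
  have [measurable]: "S \<in> borel_measurable M" "X \<in> borel_measurable M"
    using rv[THEN measurable_compose, of "\<lambda>x. x" borel] by simp_all
  have split: "\<P>(\<omega> in M. S \<omega> \<in> A \<and> X \<omega> \<in> B) = \<P>(\<omega> in M. S \<omega> \<in> A) * \<P>(\<omega> in M. X \<omega> \<in> B)" for A B
    using indep_varD[OF indep, of A B] by (simp add: vimage_def Int_def conj_ac)
  let ?A = "{\<omega> \<in> space M. S \<omega> \<ge> s}" and ?B = "{\<omega> \<in> space M. S \<omega> + X \<omega> \<ge> s + m}"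
  let ?loss = "\<lambda>i. {\<omega> \<in> space M. S \<omega> \<in> {s + i - 1} \<and> X \<omega> \<in> {..m - i}}"
  let ?gain = "\<lambda>i. {\<omega> \<in> space M. S \<omega> \<in> {s - i} \<and> X \<omega> \<in> {m + i..}}"
  have [measurable]: "?A \<in> events" "?B \<in> events"
    by measurable
  have "prob ?A = prob (?A \<inter> ?B) + prob (?A - ?B)" "prob ?B = prob (?A \<inter> ?B) + prob (?B - ?A)"
    using finite_measure_Diff'[of ?A ?B] finite_measure_Diff'[of ?B ?A] by (simp_all add: Int_commute)
  moreover have "prob (?A - ?B) = (\<Sum>i=1..m. prob (?loss i))"
  proof -
    have "?A - ?B = (\<Union>i\<in>{1..m}. ?loss i)"
    proof (intro equalityI subsetI)
      fix \<omega> assume "\<omega> \<in> ?A - ?B"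
      then show "\<omega> \<in> (\<Union>i\<in>{1..m}. ?loss i)"
        by (intro UN_I[of "S \<omega> + 1 - s"]) auto
    qed auto
    then show ?thesis
      by (simp only:) (intro finite_measure_finite_Union; auto simp: disjoint_family_on_def)
  qed
  moreover have "prob (?B - ?A) = (\<Sum>i=1..s. prob (?gain i))"
  proof -
    have "?B - ?A = (\<Union>i\<in>{1..s}. ?gain i)"
    proof (intro equalityI subsetI)
      fix \<omega> assume "\<omega> \<in> ?B - ?A"
      then show "\<omega> \<in> (\<Union>i\<in>{1..s}. ?gain i)"
        by (intro UN_I[of "s - S \<omega>"]) auto
    qed auto
    then show ?thesis
      by (simp only:) (intro finite_measure_finite_Union; auto simp: disjoint_family_on_def)
  qed
  ultimately show ?thesis
    by (simp only: split) simp
qed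

end

theorem theorem1p1:
  fixes M :: "'w measure" and S X :: "'w \<Rightarrow> nat" and s m :: nat
  assumes "prob_space M"
    and "m \<ge> 1" and "s \<ge> m"
    and "prob_space.indep_var M (count_space UNIV) S (count_space UNIV) X"
    and "right_skewed M S s"
    and "left_loaded M X m"
  shows "\<P>(\<omega> in M. S \<omega> \<ge> s) \<ge> \<P>(\<omega> in M. S \<omega> + X \<omega> \<ge> s + m)"
proof -
  interpret prob_space M by fact
  have X: "X \<in> measurable M (count_space UNIV)"
    using indep_var_rv2[OF assms(4)] .
  have mean: "has_mean M X m"
    using assms(6) by (simp add: left_loaded_def)
  define p where "p j = \<P>(\<omega> in M. S \<omega> = j)" for j
  define L where "L i = \<P>(\<omega> in M. X \<omega> \<le> m - i)" for i
  define U where "U i = \<P>(\<omega> in M. X \<omega> \<ge> m + i)" for i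
  have U_nonneg: "0 \<le> U i" for i
    by (simp add: U_def)
  have p_nonneg: "0 \<le> p j" for j
    by (simp add: p_def)
  have up: "i \<le> j \<Longrightarrow> j \<le> s \<Longrightarrow> p i \<le> p j"
    and down: "s \<le> i \<Longrightarrow> i \<le> j \<Longrightarrow> p j \<le> p i"
    and skew: "i \<in> {1..s} \<Longrightarrow> p (s - i) \<le> p (s + i - 1)" for i j
    using assms(5) unfolding right_skewed_def unimodal_rv_def p_def by auto
  have near: "(\<Sum>i=1..m. p (s - i) * U i) \<le> (\<Sum>i=1..m. p (s + i - 1) * U i)"
    using skew \<open>s \<ge> m\<close> U_nonneg by (intro sum_mono mult_right_mono) auto
  have far: "(\<Sum>i=m+1..s. p (s - i) * U i) \<le> p (s + m - 1) * (\<Sum>i=m+1..s. U i)"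
    unfolding sum_distrib_left
  proof (intro sum_mono mult_right_mono U_nonneg)
    fix i assume "i \<in> {m+1..s}"
    then have "p (s - i) \<le> p (s - m)"
      by (intro up) auto
    also have "\<dots> \<le> p (s + m - 1)"
      using \<open>m \<ge> 1\<close> \<open>s \<ge> m\<close> by (intro skew) auto
    finally show "p (s - i) \<le> p (s + m - 1)" .
  qed
  have "(\<Sum>i=1..s. p (s - i) * U i) =
      (\<Sum>i=1..m. p (s - i) * U i) + (\<Sum>i=m+1..s. p (s - i) * U i)"
    using \<open>s \<ge> m\<close> by (rule sum_split_at)
  also have "\<dots> \<le> (\<Sum>i=1..m. p (s + i - 1) * U i) + p (s + m - 1) * (\<Sum>i=m+1..s. U i)"
    using near far by (rule add_mono)
  also have "p (s + m - 1) * (\<Sum>i=m+1..s. U i) \<le> p (s + m - 1) * (\<Sum>i=1..m. tail_diff M X m i)"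
    using sum_tail_diff_ge[OF X mean \<open>s \<ge> m\<close>] p_nonneg
    by (intro mult_left_mono) (auto simp: U_def)
  also have "\<dots> \<le> (\<Sum>i=1..m. p (s + i - 1) * tail_diff M X m i)"
  proof (rule weighted_sum_ge_last_weight)
    show "p (s + Suc i - 1) \<le> p (s + i - 1)" if "1 \<le> i" for i
      using that by (intro down) auto
    show "0 \<le> (\<Sum>i=1..k. tail_diff M X m i)" if "k < m" for k
      using left_loaded_partial_sums[OF X assms(6)] that by simp
  qed
  also have "\<dots> = (\<Sum>i=1..m. p (s + i - 1) * L i) - (\<Sum>i=1..m. p (s + i - 1) * U i)"
    by (simp add: tail_diff_def L_def U_def sum_subtractf right_diff_distrib)
  finally have "(\<Sum>i=1..s. p (s - i) * U i) \<le> (\<Sum>i=1..m. p (s + i - 1) * L i)"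
    by simp
  then show ?thesis
    using prob_shift_decomposition[OF assms(4), of s m] by (simp add: p_def L_def U_def)
qed

end
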